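(* Let $G$ be any graph of order $n$. If $H$ is any graph with root $v\in V(H)$, then $$\nu_I(G\circ_v H)\in\bigl\{\,n\,\nu_I(H)-\beta(G),\ \ n\,\nu_I(H),\ \ n\,\nu_I(H)+\nu_I(G)\,\bigr\}.$$
   Context: All graphs are finite and simple; the order of a graph is its number of vertices. A matching $M$ of a graph $G$ is an induced matching if no two distinct edges of $M$ are joined by an edge of $G$; $\nu_I(G)$ denotes the maximum cardinality of an induced matching in $G$. $\beta(G)$ is the vertex cover number of $G$. For a graph $G$ with $V(G)=\{v_1,\ldots,v_n\}$ and a graph $H$ with a distinguished vertex (root) $v$, the rooted product $G\circ_v H$ has vertex set $V(G)\times V(H)$ and edge set $$\bigcup_{i=1}^{n}\{(v_i,h)(v_i,h')\mid hh'\in E(H)\}\ \cup\ \{(v_i,v)(v_j,v)\mid v_iv_j\in E(G)\}.$$ *)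

theory Defs
  imports Main
begin

record 'a ugraph =
  verts :: "'a set"
  edges :: "'a set set"

definition finite_simple_graph :: "'a ugraph \<Rightarrow> bool" where
  "finite_simple_graph G \<longleftrightarrow>
     finite (verts G) \<and> (\<forall>e \<in> edges G. e \<subseteq> verts G \<and> card e = 2)"

definition matching :: "'a ugraph \<Rightarrow> 'a set set \<Rightarrow> bool" where
  "matching G M \<longleftrightarrow> M \<subseteq> edges G \<and> pairwise disjnt M"

definition induced_matching :: "'a ugraph \<Rightarrow> 'a set set \<Rightarrow> bool" where
  "induced_matching G M \<longleftrightarrow>
     matching G M \<and>
     (\<forall>e \<in> M. \<forall>f \<in> M. e \<noteq> f \<longrightarrow> \<not> (\<exists>x \<in> e. \<exists>y \<in> f. {x, y} \<in> edges G))"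

definition induced_matching_number :: "'a ugraph \<Rightarrow> nat" where
  "induced_matching_number G = Max (card ` {M. induced_matching G M})"

definition vertex_cover :: "'a ugraph \<Rightarrow> 'a set \<Rightarrow> bool" where
  "vertex_cover G C \<longleftrightarrow> C \<subseteq> verts G \<and> (\<forall>e \<in> edges G. e \<inter> C \<noteq> {})"

definition vertex_cover_number :: "'a ugraph \<Rightarrow> nat" where
  "vertex_cover_number G = Min (card ` {C. vertex_cover G C})"

definition rooted_product :: "'a ugraph \<Rightarrow> 'b \<Rightarrow> 'b ugraph \<Rightarrow> ('a \<times> 'b) ugraph" where
  "rooted_product G v H =
     \<lparr> verts = verts G \<times> verts H,
       edges = {{(x, h), (x, h')} | x h h'. x \<in> verts G \<and> {h, h'} \<in> edges H}
             \<union> {{(x, v), (y, v)} | x y. {x, y} \<in> edges G} \<rparr>"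

lemma finite_simple_graph_rooted_product:
  assumes "finite_simple_graph G" "finite_simple_graph H" "v \<in> verts H"
  shows "finite_simple_graph (rooted_product G v H)"
proof -
  have ne: "a \<noteq> b" if "card {a, b} = 2" for a b :: 'c
    using that by auto
  show ?thesis
    using assms unfolding finite_simple_graph_def rooted_product_def
    by (fastforce dest: ne simp: card_insert_if)
qed

end

theory Submission
  imports Defs
begin

text \<open>
  An induced matching of the rooted product splits into an induced matching \<open>N x\<close> of \<open>H\<close> for
  every vertex \<open>x\<close> of \<open>G\<close> and an induced matching \<open>R\<close> of the root copy of \<open>G\<close>. Call a maximum
  induced matching of \<open>H\<close> free if it contains no vertex of the closed neighbourhood of \<open>v\<close>. If a
  free one exists, use it in every fibre together with a maximum \<open>R\<close>. If none exists, every
  edge of \<open>R\<close> gains \<open>1\<close> but costs at least \<open>1\<close> at each of its ends, so \<open>R\<close> does not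
  help; if moreover every maximum induced matching of \<open>H\<close> covers \<open>v\<close>, the fibres that cover \<open>v\<close>
  sit over an independent set, which stays independent after adding one end of each edge of \<open>R\<close>.
\<close>

section \<open>Closed neighbourhoods and induced matchings\<close>

text \<open>Equality and adjacency in one relation, so that disjointness of two edges and the
  absence of an edge joining them become a single condition.\<close>

definition near :: "'a ugraph \<Rightarrow> 'a \<Rightarrow> 'a \<Rightarrow> bool" where
  "near G x y \<longleftrightarrow> x = y \<or> {x, y} \<in> edges G"

lemma near_refl [simp]: "near G x x"
  by (simp add: near_def)

lemma near_commute: "near G x y \<longleftrightarrow> near G y x"
  by (auto simp: near_def insert_commute)

text \<open>This is the condition under which \<open>M\<close>, placed in the fibre over a vertex of
  \<open>G\<close>, is compatible with a root edge ending at that vertex.\<close>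

definition free_at :: "'a ugraph \<Rightarrow> 'a \<Rightarrow> 'a set set \<Rightarrow> bool" where
  "free_at G v M \<longleftrightarrow> (\<forall>x \<in> \<Union>M. \<not> near G v x)"

lemma free_at_not_covered: "free_at G v M \<Longrightarrow> v \<notin> \<Union>M"
  unfolding free_at_def by (metis near_refl)

lemma induced_matching_iff:
  "induced_matching G M \<longleftrightarrow>
     M \<subseteq> edges G \<and> (\<forall>e\<in>M. \<forall>f\<in>M. e \<noteq> f \<longrightarrow> (\<forall>x\<in>e. \<forall>y\<in>f. \<not> near G x y))"
proof -
  have "pairwise disjnt M \<longleftrightarrow> (\<forall>e\<in>M. \<forall>f\<in>M. e \<noteq> f \<longrightarrow> (\<forall>x\<in>e. \<forall>y\<in>f. x \<noteq> y))"
    unfolding pairwise_def disjnt_iff by metis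
  then show ?thesis
    unfolding induced_matching_def matching_def near_def
    by (simp add: ball_conj_distrib imp_conjR)
qed

lemma induced_matching_empty: "induced_matching G {}"
  by (simp add: induced_matching_iff)

lemma induced_matching_subset:
  "induced_matching G M \<Longrightarrow> M' \<subseteq> M \<Longrightarrow> induced_matching G M'"
  unfolding induced_matching_iff by blast

section \<open>Edges, finiteness and extremal sets\<close>

lemma edge_subset_verts: "finite_simple_graph G \<Longrightarrow> e \<in> edges G \<Longrightarrow> e \<subseteq> verts G"
  by (simp add: finite_simple_graph_def)

lemma edge_verts:
  assumes "finite_simple_graph G" "{x, y} \<in> edges G"
  shows "x \<in> verts G" "y \<in> verts G" "x \<noteq> y"
  using assms unfolding finite_simple_graph_def by force+

lemma edge_eq_pair:
  assumes "finite_simple_graph G" "e \<in> edges G"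
  obtains x y where "e = {x, y}"
  using assms by (meson card_2_iff finite_simple_graph_def)

lemma edge_nonempty: "finite_simple_graph G \<Longrightarrow> e \<in> edges G \<Longrightarrow> e \<noteq> {}"
  by (auto simp: finite_simple_graph_def)

lemma finite_edges: "finite_simple_graph G \<Longrightarrow> finite (edges G)"
  by (metis PowI edge_subset_verts finite_Pow_iff finite_simple_graph_def finite_subset subsetI)

lemma finite_induced_matching:
  "finite_simple_graph G \<Longrightarrow> induced_matching G M \<Longrightarrow> finite M"
  by (meson finite_edges finite_subset induced_matching_iff)

lemma finite_induced_matchings:
  assumes "finite_simple_graph G"
  shows "finite {M. induced_matching G M}"
  by (rule finite_subset[of _ "Pow (edges G)"])
    (auto simp: induced_matching_iff finite_edges[OF assms])

lemma card_le_induced_matching_number: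
  "finite_simple_graph G \<Longrightarrow> induced_matching G M \<Longrightarrow> card M \<le> induced_matching_number G"
  unfolding induced_matching_number_def
  by (rule Max_ge) (auto simp: finite_induced_matchings)

lemma maximum_induced_matching_exists:
  assumes "finite_simple_graph G"
  obtains M where "induced_matching G M" "card M = induced_matching_number G"
proof -
  have "Max (card ` {M. induced_matching G M}) \<in> card ` {M. induced_matching G M}"
    using induced_matching_empty[of G]
    by (intro Max_in) (auto simp: finite_induced_matchings[OF assms])
  then show thesis
    using that unfolding induced_matching_number_def by auto
qed

lemma induced_matching_number_eqI:
  assumes "finite_simple_graph G" "induced_matching G M" "card M = m"
    and "\<And>M'. induced_matching G M' \<Longrightarrow> card M' \<le> m"
  shows "induced_matching_number G = m"
  by (metis assms card_le_induced_matching_number maximum_induced_matching_exists le_antisym)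

lemma finite_vertex_covers:
  assumes "finite_simple_graph G"
  shows "finite {C. vertex_cover G C}"
  by (rule finite_subset[of _ "Pow (verts G)"])
    (use assms in \<open>auto simp: vertex_cover_def finite_simple_graph_def\<close>)

lemma vertex_cover_number_le:
  "finite_simple_graph G \<Longrightarrow> vertex_cover G C \<Longrightarrow> vertex_cover_number G \<le> card C"
  unfolding vertex_cover_number_def
  by (rule Min_le) (auto simp: finite_vertex_covers)

lemma minimum_vertex_cover_exists:
  assumes "finite_simple_graph G"
  obtains C where "vertex_cover G C" "card C = vertex_cover_number G"
proof -
  have "vertex_cover G (verts G)"
    using edge_nonempty[OF assms] edge_subset_verts[OF assms]
    by (auto simp: vertex_cover_def)
  then have "Min (card ` {C. vertex_cover G C}) \<in> card ` {C. vertex_cover G C}"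
    by (intro Min_in) (auto simp: finite_vertex_covers[OF assms])
  then show thesis
    using that unfolding vertex_cover_number_def by auto
qed

section \<open>Edges and adjacency of the rooted product\<close>

text \<open>One shape for three uses: the whole edge set of the product, the matchings built for the
  lower bounds, and the decomposition of an arbitrary induced matching.\<close>

definition product_edges ::
  "'a set \<Rightarrow> 'b \<Rightarrow> ('a \<Rightarrow> 'b set set) \<Rightarrow> 'a set set \<Rightarrow> ('a \<times> 'b) set set" where
  "product_edges V v N R = (\<Union>x\<in>V. (`) (Pair x) ` N x) \<union> (`) (\<lambda>x. (x, v)) ` R"

lemma product_edgesE:
  assumes "e \<in> product_edges V v N R"
  obtains (fibre) x d where "x \<in> V" "d \<in> N x" "e = Pair x ` d"
    | (root) d where "d \<in> R" "e = (\<lambda>x. (x, v)) ` d"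
  using assms unfolding product_edges_def by blast

lemma fibre_in_product_edges: "x \<in> V \<Longrightarrow> d \<in> N x \<Longrightarrow> Pair x ` d \<in> product_edges V v N R"
  by (auto simp: product_edges_def)

lemma root_in_product_edges: "d \<in> R \<Longrightarrow> (\<lambda>x. (x, v)) ` d \<in> product_edges V v N R"
  by (auto simp: product_edges_def)

lemma edges_rooted_product:
  assumes "finite_simple_graph G" "finite_simple_graph H"
  shows "edges (rooted_product G v H) = product_edges (verts G) v (\<lambda>_. edges H) (edges G)"
proof (intro equalityI subsetI)
  fix e assume "e \<in> edges (rooted_product G v H)"
  then consider (fibre) x h h' where "x \<in> verts G" "{h, h'} \<in> edges H" "e = {(x, h), (x, h')}"
    | (root) x y where "{x, y} \<in> edges G" "e = {(x, v), (y, v)}"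
    unfolding rooted_product_def by auto
  then show "e \<in> product_edges (verts G) v (\<lambda>_. edges H) (edges G)"
  proof cases
    case fibre
    then have "e = Pair x ` {h, h'}" by simp
    then show ?thesis using fibre fibre_in_product_edges by metis
  next
    case root
    then have "e = (\<lambda>x. (x, v)) ` {x, y}" by simp
    then show ?thesis using root root_in_product_edges by metis
  qed
next
  fix e assume "e \<in> product_edges (verts G) v (\<lambda>_. edges H) (edges G)"
  then show "e \<in> edges (rooted_product G v H)"
  proof (cases rule: product_edgesE)
    case (fibre x d)
    obtain h h' where "d = {h, h'}" using edge_eq_pair[OF assms(2) fibre(2)] .
    then show ?thesis using fibre unfolding rooted_product_def by auto
  next
    case (root d)
    obtain x y where "d = {x, y}" using edge_eq_pair[OF assms(1) root(1)] .
    then show ?thesis using root unfolding rooted_product_def by auto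
  qed
qed

text \<open>Adjacency stays inside a fibre or runs between roots. The assumption reflects that edges
  of \<open>H\<close> are copied only over vertices of \<open>G\<close>.\<close>

lemma near_rooted_product:
  assumes "x \<in> verts G"
  shows "near (rooted_product G v H) (x, h) (y, h') \<longleftrightarrow>
    x = y \<and> near H h h' \<or> h = v \<and> h' = v \<and> near G x y"
proof -
  have "{(x, h), (y, h')} \<in> edges (rooted_product G v H) \<longleftrightarrow>
    x = y \<and> {h, h'} \<in> edges H \<or> h = v \<and> h' = v \<and> {x, y} \<in> edges G"
    using assms unfolding rooted_product_def
    by (auto simp: doubleton_eq_iff insert_commute)
  then show ?thesis
    unfolding near_def by auto
qed

text \<open>A root edge shows two different first coordinates, a fibre image at most one.\<close>

lemma root_image_ne_fibre_image:
  assumes "finite_simple_graph G" "d \<in> edges G"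
  shows "(\<lambda>x. (x, v)) ` d \<noteq> Pair x ` d'"
proof
  assume eq: "(\<lambda>x. (x, v)) ` d = Pair x ` d'"
  obtain a b where ab: "d = {a, b}" using edge_eq_pair[OF assms] .
  then have "a \<noteq> b" using edge_verts(3)[OF assms(1)] assms(2) by blast
  moreover have "(a, v) \<in> Pair x ` d'" "(b, v) \<in> Pair x ` d'" using eq ab by auto
  ultimately show False by auto
qed

text \<open>The embeddings are injective and the union is disjoint: as edges are nonempty, first
  coordinates tell fibres apart, and root edges are never fibre edges.\<close>

lemma card_product_edges:
  assumes G: "finite_simple_graph G" and H: "finite_simple_graph H"
    and N: "\<And>x. x \<in> verts G \<Longrightarrow> N x \<subseteq> edges H" and R: "R \<subseteq> edges G"
  shows "card (product_edges (verts G) v N R) = (\<Sum>x\<in>verts G. card (N x)) + card R"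
proof -
  have finV: "finite (verts G)" using G by (simp add: finite_simple_graph_def)
  have finN: "finite (N x)" if "x \<in> verts G" for x
    using N[OF that] finite_edges[OF H] finite_subset by blast
  have finR: "finite R" using R finite_edges[OF G] finite_subset by blast
  have inj: "inj_on ((`) (Pair x)) A" "inj_on ((`) (\<lambda>x. (x, v))) B"
    for x :: 'a and A :: "'b set set" and B :: "'a set set"
    by (rule inj_on_image, simp add: inj_on_def)+
  have "card (\<Union>x\<in>verts G. (`) (Pair x) ` N x) = (\<Sum>x\<in>verts G. card ((`) (Pair x) ` N x))"
  proof (rule card_UN_disjoint)
    show "\<forall>x\<in>verts G. \<forall>y\<in>verts G.
        x \<noteq> y \<longrightarrow> (`) (Pair x) ` N x \<inter> (`) (Pair y) ` N y = {}"
    proof (intro ballI impI)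
      fix x y assume "x \<in> verts G" "y \<in> verts G" "x \<noteq> y"
      then have "Pair x ` d \<noteq> Pair y ` d'" if "d \<in> N x" for d d'
        using edge_nonempty[OF H, of d] N[of x] that by auto
      then show "(`) (Pair x) ` N x \<inter> (`) (Pair y) ` N y = {}" by auto
    qed
  qed (use finV finN in auto)
  also have "\<dots> = (\<Sum>x\<in>verts G. card (N x))"
    by (simp add: card_image inj)
  finally have fibres: "card (\<Union>x\<in>verts G. (`) (Pair x) ` N x) = (\<Sum>x\<in>verts G. card (N x))" .
  have "Pair x ` d \<noteq> (\<lambda>x. (x, v)) ` d'" if "d' \<in> R" for x d d'
    using that R by (intro root_image_ne_fibre_image[OF G, symmetric]) blast
  then have "(\<Union>x\<in>verts G. (`) (Pair x) ` N x) \<inter> (`) (\<lambda>x. (x, v)) ` R = {}" by blast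
  then show ?thesis
    unfolding product_edges_def
    using finV finN finR by (simp add: card_Un_disjoint fibres card_image inj)
qed

section \<open>Assembling induced matchings of the product\<close>

text \<open>The last three assumptions exclude the possible conflicts between parts:
  \<open>free\<close> a root edge against the fibre over one of its ends, \<open>indep\<close> two
  adjacent fibres that both use the root, \<open>sep\<close> a root edge against a fibre adjacent to
  one of its ends.\<close>

lemma induced_matching_product_edgesI:
  assumes G: "finite_simple_graph G" and H: "finite_simple_graph H"
    and N: "\<And>x. x \<in> verts G \<Longrightarrow> induced_matching H (N x)"
    and R: "induced_matching G R"
    and free: "\<And>x. x \<in> \<Union>R \<Longrightarrow> free_at H v (N x)"
    and indep: "\<And>x y. {x, y} \<in> edges G \<Longrightarrow> v \<in> \<Union>(N x) \<Longrightarrow> v \<notin> \<Union>(N y)"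
    and sep: "\<And>x y. {x, y} \<in> edges G \<Longrightarrow> x \<in> \<Union>R \<Longrightarrow> v \<notin> \<Union>(N y)"
  shows "induced_matching (rooted_product G v H) (product_edges (verts G) v N R)"
proof -
  let ?P = "rooted_product G v H" and ?M = "product_edges (verts G) v N R"
  have NE: "N x \<subseteq> edges H" if "x \<in> verts G" for x
    using N[OF that] by (simp add: induced_matching_iff)
  have RE: "R \<subseteq> edges G" using R by (simp add: induced_matching_iff)
  have RV: "x \<in> verts G" if "d \<in> R" "x \<in> d" for x d
    using that RE edge_subset_verts[OF G] by blast
  \<comment> \<open>The mixed case is settled once, with the fibre point first; symmetry of
    \<open>near\<close> gives the other order.\<close>
  have fr: "\<not> near ?P (x, h) (y, v)"
    if xy: "x \<in> verts G" "d \<in> N x" "h \<in> d" "d' \<in> R" "y \<in> d'" for x y h d d'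
  proof
    assume "near ?P (x, h) (y, v)"
    then consider "x = y" "near H h v" | "h = v" "x = y" | "h = v" "{y, x} \<in> edges G"
      using xy(1) by (auto simp: near_rooted_product near_def[of G] insert_commute)
    then show False
    proof cases
      case 1
      then show ?thesis using free[of y] xy near_commute[of H h v] by (auto simp: free_at_def)
    next
      case 2
      then show ?thesis using free_at_not_covered[OF free[of y]] xy by auto
    next
      case 3
      then show ?thesis using sep[of y x] xy by auto
    qed
  qed
  have "?M \<subseteq> edges ?P"
    unfolding edges_rooted_product[OF G H] product_edges_def
    using NE RE by (intro Un_mono UN_mono image_mono subset_refl)
  moreover have "\<not> near ?P p q" if ef: "e \<in> ?M" "f \<in> ?M" "e \<noteq> f" "p \<in> e" "q \<in> f" for e f p q
    using ef(1)
  proof (cases rule: product_edgesE)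
    case e: (fibre x d)
    then obtain h where h: "p = (x, h)" "h \<in> d" using ef by auto
    show ?thesis
      using ef(2)
    proof (cases rule: product_edgesE)
      case f: (fibre y d')
      then obtain h' where h': "q = (y, h')" "h' \<in> d'" using ef by auto
      show ?thesis
      proof (cases "x = y")
        case True
        then have "d \<noteq> d'" using e f ef by auto
        then have "\<not> near H h h'"
          using N[OF e(1)] e f h h' True unfolding induced_matching_iff by blast
        then show ?thesis
          using True h h' e(1) by (auto simp: near_rooted_product)
      next
        case False
        then have "{x, y} \<notin> edges G" if "h = v" "h' = v"
          using indep[of x y] e f h h' that by auto
        then show ?thesis
          using False h h' e(1) by (auto simp: near_rooted_product near_def[of G])
      qed
    next
      case f: (root d')
      then show ?thesis using fr[OF e(1,2) h(2) f(1)] h ef by auto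
    qed
  next
    case e: (root d)
    then obtain x where x: "p = (x, v)" "x \<in> d" using ef by auto
    show ?thesis
      using ef(2)
    proof (cases rule: product_edgesE)
      case f: (fibre y d')
      then obtain h' where "q = (y, h')" "h' \<in> d'" using ef by auto
      then show ?thesis using fr[OF f(1,2) _ e(1)] x near_commute by metis
    next
      case f: (root d')
      then obtain y where y: "q = (y, v)" "y \<in> d'" using ef by auto
      have "d \<noteq> d'" using e f ef by auto
      then have "\<not> near G x y" using R e f x y unfolding induced_matching_iff by blast
      then show ?thesis using x y RV[OF e(1) x(2)] by (auto simp: near_rooted_product)
    qed
  qed
  ultimately show ?thesis
    unfolding induced_matching_iff by blast
qed

section \<open>Decomposing induced matchings of the product\<close>

text \<open>\<open>T\<close> contains one end of each root edge of \<open>M\<close>.\<close>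

lemma induced_matching_rooted_product_decompose:
  assumes G: "finite_simple_graph G" and H: "finite_simple_graph H"
    and M: "induced_matching (rooted_product G v H) M"
  obtains N T where
    "card M = (\<Sum>x\<in>verts G. card (N x)) + card T"
    "\<forall>x\<in>verts G. induced_matching H (N x)"
    "T \<subseteq> verts G" "card T \<le> induced_matching_number G"
    "\<forall>x\<in>T. free_at H v (N x)"
    "\<forall>x \<in> T \<union> {x. v \<in> \<Union>(N x)}. \<forall>y \<in> T \<union> {x. v \<in> \<Union>(N x)}. {x, y} \<notin> edges G"
proof -
  let ?P = "rooted_product G v H"
  \<comment> \<open>Pull \<open>M\<close> back along the embeddings of \<open>H\<close> as a fibre
    and of \<open>G\<close> as the root copy. Every edge of the product is of one of these kinds, so
    nothing is lost.\<close>
  define N where "N = (\<lambda>x. {d \<in> edges H. Pair x ` d \<in> M})"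
  define R where "R = {d \<in> edges G. (\<lambda>x. (x, v)) ` d \<in> M}"
  have sub: "M \<subseteq> edges ?P" using M by (simp add: induced_matching_iff)
  have M_eq: "M = product_edges (verts G) v N R"
  proof (intro equalityI subsetI)
    fix e assume e: "e \<in> M"
    then have "e \<in> product_edges (verts G) v (\<lambda>_. edges H) (edges G)"
      using sub edges_rooted_product[OF G H] by blast
    then show "e \<in> product_edges (verts G) v N R"
      using e by (cases rule: product_edgesE)
        (auto simp: N_def R_def intro: fibre_in_product_edges root_in_product_edges)
  next
    fix e assume "e \<in> product_edges (verts G) v N R"
    then show "e \<in> M"
      by (cases rule: product_edgesE) (auto simp: N_def R_def)
  qed
  have far: "\<not> near ?P p q" if "e \<in> M" "f \<in> M" "e \<noteq> f" "p \<in> e" "q \<in> f" for e f p q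
    using M that unfolding induced_matching_iff by blast
  have NV: "induced_matching H (N x)" if x: "x \<in> verts G" for x
  proof -
    have "\<not> near H h h'" if "d \<in> N x" "d' \<in> N x" "d \<noteq> d'" "h \<in> d" "h' \<in> d'" for d d' h h'
    proof -
      have "Pair x ` d \<noteq> Pair x ` d'" using that by (auto simp: inj_image_eq_iff inj_def)
      then have "\<not> near ?P (x, h) (x, h')"
        using far[of "Pair x ` d" "Pair x ` d'"] that by (auto simp: N_def)
      then show ?thesis using x by (simp add: near_rooted_product)
    qed
    then show ?thesis unfolding induced_matching_iff by (auto simp: N_def)
  qed
  have RV: "x \<in> verts G" if "d \<in> R" "x \<in> d" for x d
    using that edge_subset_verts[OF G] by (auto simp: R_def)
  have far_R: "\<not> near G x y" if "d \<in> R" "d' \<in> R" "d \<noteq> d'" "x \<in> d" "y \<in> d'" for d d' x y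
  proof -
    have "(\<lambda>x. (x, v)) ` d \<noteq> (\<lambda>x. (x, v)) ` d'" using that by (auto simp: inj_image_eq_iff inj_def)
    then have "\<not> near ?P (x, v) (y, v)"
      using far[of "(\<lambda>x. (x, v)) ` d" "(\<lambda>x. (x, v)) ` d'"] that by (auto simp: R_def)
    then show ?thesis using RV that by (simp add: near_rooted_product)
  qed
  then have R: "induced_matching G R" unfolding induced_matching_iff by (auto simp: R_def)
  have root_ne_fibre: "(\<lambda>x. (x, v)) ` d \<noteq> Pair x ` d'" if "d \<in> R" for x d d'
    using that by (intro root_image_ne_fibre_image[OF G]) (simp add: R_def)
  have far_RN: "\<not> near ?P (x, v) (y, h)" if "d \<in> R" "x \<in> d" "d' \<in> N y" "h \<in> d'" for x y h d d'
    using far[OF _ _ root_ne_fibre[OF that(1)], of y d' "(x, v)" "(y, h)"] that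
    by (auto simp: R_def N_def)
  have "\<exists>x. x \<in> d" if "d \<in> R" for d
    using that edge_nonempty[OF G] by (auto simp: R_def)
  \<comment> \<open>Only one end per root edge is chosen: the two ends are adjacent in
    \<open>G\<close>, so taking both would destroy the independence claimed at the end.\<close>
  then obtain t where t: "\<And>d. d \<in> R \<Longrightarrow> t d \<in> d" by metis
  have inj: "inj_on t R"
  proof (rule inj_onI)
    fix d d' assume "d \<in> R" "d' \<in> R" "t d = t d'"
    \<comment> \<open>A vertex is near itself, so by \<open>far_R\<close> two different root edges
      cannot share their chosen end.\<close>
    then show "d = d'" using far_R[of d d' "t d" "t d'"] t[of d] t[of d'] by auto
  qed
  show thesis
  proof
    have "card M = (\<Sum>x\<in>verts G. card (N x)) + card R"
      unfolding M_eq by (rule card_product_edges[OF G H]) (auto simp: N_def R_def)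
    then show "card M = (\<Sum>x\<in>verts G. card (N x)) + card (t ` R)"
      by (simp add: card_image inj)
    show "card (t ` R) \<le> induced_matching_number G"
      using card_le_induced_matching_number[OF G R] by (simp add: card_image inj)
    show "t ` R \<subseteq> verts G" using t RV by blast
    show "\<forall>x\<in>verts G. induced_matching H (N x)" using NV by blast
    show "\<forall>x\<in>t ` R. free_at H v (N x)"
    proof
      fix x assume "x \<in> t ` R"
      then obtain d where d: "d \<in> R" "x \<in> d" using t by blast
      show "free_at H v (N x)"
        unfolding free_at_def
        using far_RN[OF d, of _ x] RV[OF d] by (auto simp: near_rooted_product)
    qed
    let ?I = "t ` R \<union> {x. v \<in> \<Union>(N x)}"
    show "\<forall>x\<in>?I. \<forall>y\<in>?I. {x, y} \<notin> edges G"
    proof (intro ballI notI)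
      fix x y assume xy: "x \<in> ?I" "y \<in> ?I"
      assume E: "{x, y} \<in> edges G"
      note V = edge_verts[OF G E]
      have nG: "near G x y" using E by (simp add: near_def)
      have nP: "near ?P (x, v) (y, v)" "near ?P (y, v) (x, v)"
        using V nG near_commute[of G x] by (auto simp: near_rooted_product)
      \<comment> \<open>A vertex is in \<open>?I\<close> as a chosen end or because its fibre covers
        \<open>v\<close>. In each combination, two different edges of \<open>M\<close> would contain
        the adjacent points \<open>(x, v)\<close> and \<open>(y, v)\<close>.\<close>
      consider (RR) d d' where "d \<in> R" "d' \<in> R" "x = t d" "y = t d'"
        | (RN) d d' where "d \<in> R" "x \<in> d" "d' \<in> N y" "v \<in> d'"
        | (NR) d d' where "d \<in> R" "y \<in> d" "d' \<in> N x" "v \<in> d'"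
        | (NN) d d' where "d \<in> N x" "v \<in> d" "d' \<in> N y" "v \<in> d'"
        using xy t by blast
      then show False
      proof cases
        case RR
        then have "d \<noteq> d'" using V(3) by auto
        then show ?thesis using far_R RR t nG by metis
      next
        case RN
        then show ?thesis using far_RN nP by metis
      next
        case NR
        then show ?thesis using far_RN nP by metis
      next
        case NN
        then have "Pair x ` d \<noteq> Pair y ` d'" using V(3) by auto
        then show ?thesis
          using far[of "Pair x ` d" "Pair y ` d'" "(x, v)" "(y, v)"] NN nP by (auto simp: N_def)
      qed
    qed
  qed
qed

section \<open>The three values of the induced matching number\<close>

text \<open>The upper bound just adds the separate maxima of the fibres and of the root copy. A free
  \<open>L\<close> in every fibre attains it, since it conflicts with no root edge.\<close>

lemma induced_matching_number_rooted_product_free: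
  assumes G: "finite_simple_graph G" and H: "finite_simple_graph H" and v: "v \<in> verts H"
    and L: "induced_matching H L" "card L = induced_matching_number H" "free_at H v L"
  shows "induced_matching_number (rooted_product G v H) =
    card (verts G) * induced_matching_number H + induced_matching_number G"
proof -
  obtain R where R: "induced_matching G R" "card R = induced_matching_number G"
    using maximum_induced_matching_exists[OF G] .
  show ?thesis
  proof (rule induced_matching_number_eqI)
    show "finite_simple_graph (rooted_product G v H)"
      using finite_simple_graph_rooted_product[OF G H v] .
    show "induced_matching (rooted_product G v H) (product_edges (verts G) v (\<lambda>_. L) R)"
      using free_at_not_covered[OF L(3)] L R by (intro induced_matching_product_edgesI[OF G H]) auto
    show "card (product_edges (verts G) v (\<lambda>_. L) R) =
        card (verts G) * induced_matching_number H + induced_matching_number G"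
      using L R by (subst card_product_edges[OF G H]) (auto simp: induced_matching_iff)
    fix M assume M: "induced_matching (rooted_product G v H) M"
    obtain N T where *: "card M = (\<Sum>x\<in>verts G. card (N x)) + card T"
        "\<forall>x\<in>verts G. induced_matching H (N x)"
        "T \<subseteq> verts G" "card T \<le> induced_matching_number G"
        "\<forall>x\<in>T. free_at H v (N x)"
        "\<forall>x \<in> T \<union> {x. v \<in> \<Union>(N x)}. \<forall>y \<in> T \<union> {x. v \<in> \<Union>(N x)}. {x, y} \<notin> edges G"
      using induced_matching_rooted_product_decompose[OF G H M] .
    have "(\<Sum>x\<in>verts G. card (N x)) \<le> card (verts G) * induced_matching_number H"
      using sum_bounded_above[of "verts G" "\<lambda>x. card (N x)"]
        card_le_induced_matching_number[OF H] *(2) by simp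
    then show "card M \<le> card (verts G) * induced_matching_number H + induced_matching_number G"
      using * by simp
  qed
qed

text \<open>Spreads a cardinality over the fibres, so that global counts can be compared fibre by
  fibre.\<close>

lemma sum_of_bool_eq_card:
  assumes "finite V" "T \<subseteq> V"
  shows "(\<Sum>x\<in>V. of_bool (x \<in> T)) = card T"
  using assms by (simp add: Int_absorb1)

text \<open>Each root edge is charged to the fibre over its chosen end. That fibre is free at
  \<open>v\<close>, hence below the maximum by at least one, which pays for the edge. Copies of
  \<open>L\<close> without root edges attain the bound, as none of them uses the root.\<close>

lemma induced_matching_number_rooted_product_uncovered:
  assumes G: "finite_simple_graph G" and H: "finite_simple_graph H" and v: "v \<in> verts H"
    and L: "induced_matching H L" "card L = induced_matching_number H" "v \<notin> \<Union>L"
    and not_free: "\<And>L. induced_matching H L \<Longrightarrow> free_at H v L \<Longrightarrow> card L \<noteq> induced_matching_number H"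
  shows "induced_matching_number (rooted_product G v H) =
    card (verts G) * induced_matching_number H"
proof (rule induced_matching_number_eqI)
  show "finite_simple_graph (rooted_product G v H)"
    using finite_simple_graph_rooted_product[OF G H v] .
  show "induced_matching (rooted_product G v H) (product_edges (verts G) v (\<lambda>_. L) {})"
    using L by (intro induced_matching_product_edgesI[OF G H]) (auto simp: induced_matching_empty)
  show "card (product_edges (verts G) v (\<lambda>_. L) {}) = card (verts G) * induced_matching_number H"
    using L by (subst card_product_edges[OF G H]) (auto simp: induced_matching_iff)
  have fin: "finite (verts G)" using G by (simp add: finite_simple_graph_def)
  fix M assume M: "induced_matching (rooted_product G v H) M"
  obtain N T where *: "card M = (\<Sum>x\<in>verts G. card (N x)) + card T"
      "\<forall>x\<in>verts G. induced_matching H (N x)"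
      "T \<subseteq> verts G" "card T \<le> induced_matching_number G"
      "\<forall>x\<in>T. free_at H v (N x)"
      "\<forall>x \<in> T \<union> {x. v \<in> \<Union>(N x)}. \<forall>y \<in> T \<union> {x. v \<in> \<Union>(N x)}. {x, y} \<notin> edges G"
    using induced_matching_rooted_product_decompose[OF G H M] .
  have "card M = (\<Sum>x\<in>verts G. card (N x) + of_bool (x \<in> T))"
    using * sum_of_bool_eq_card[OF fin *(3)] by (simp add: sum.distrib)
  also have "\<dots> \<le> (\<Sum>x\<in>verts G. induced_matching_number H)"
  proof (rule sum_mono)
    fix x assume "x \<in> verts G"
    then show "card (N x) + of_bool (x \<in> T) \<le> induced_matching_number H"
      using card_le_induced_matching_number[OF H, of "N x"] not_free[of "N x"] *(2,5)
      by (cases "x \<in> T") auto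
  qed
  finally show "card M \<le> card (verts G) * induced_matching_number H" by simp
qed

text \<open>Fibres of maximum size all cover \<open>v\<close>, so they sit over an independent set,
  and the fibres that lose an edge sit over a vertex cover. The additive form avoids truncated
  subtraction.\<close>

lemma induced_matching_number_rooted_product_covered:
  assumes G: "finite_simple_graph G" and H: "finite_simple_graph H" and v: "v \<in> verts H"
    and covered: "\<And>L. induced_matching H L \<Longrightarrow> v \<notin> \<Union>L \<Longrightarrow> card L \<noteq> induced_matching_number H"
  shows "induced_matching_number (rooted_product G v H) + vertex_cover_number G =
    card (verts G) * induced_matching_number H"
proof -
  let ?k = "induced_matching_number H" and ?V = "verts G"
  have fin: "finite ?V" using G by (simp add: finite_simple_graph_def)
  obtain C where C: "vertex_cover G C" "card C = vertex_cover_number G"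
    using minimum_vertex_cover_exists[OF G] .
  then have CV: "C \<subseteq> ?V" by (simp add: vertex_cover_def)
  obtain L where L: "induced_matching H L" "card L = ?k"
    using maximum_induced_matching_exists[OF H] .
  then obtain d where d: "d \<in> L" "v \<in> d" using covered by blast
  \<comment> \<open>Dropping the one edge at \<open>v\<close> frees the root at the cost of one
    edge, the least possible cost by \<open>covered\<close>.\<close>
  define L' where "L' = L - {d}"
  have L': "induced_matching H L'"
    using L(1) by (auto simp: L'_def intro: induced_matching_subset)
  have finL: "finite L" using finite_induced_matching[OF H L(1)] .
  have card_L': "card L = card L' + 1"
    using card_Suc_Diff1[OF finL d(1)] by (simp add: L'_def)
  then have k: "?k > 0" using L by simp
  have vL': "v \<notin> \<Union>L'"
  proof
    assume "v \<in> \<Union>L'"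
    then obtain e where e: "e \<in> L" "e \<noteq> d" "v \<in> e" by (auto simp: L'_def)
    then have "\<not> near H v v" using L(1) d unfolding induced_matching_iff by blast
    then show False by simp
  qed
  \<comment> \<open>Fibres over the minimum cover give up the root. Every edge of \<open>G\<close>
    has an end in \<open>C\<close>, so no two adjacent fibres both use it.\<close>
  define N where "N = (\<lambda>x. if x \<in> C then L' else L)"
  have "induced_matching_number (rooted_product G v H) = card ?V * ?k - vertex_cover_number G"
  proof (rule induced_matching_number_eqI)
    show "finite_simple_graph (rooted_product G v H)"
      using finite_simple_graph_rooted_product[OF G H v] .
    show "induced_matching (rooted_product G v H) (product_edges ?V v N {})"
    proof (intro induced_matching_product_edgesI[OF G H])
      fix x y assume "{x, y} \<in> edges G" and vN: "v \<in> \<Union>(N x)"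
      then have "{x, y} \<inter> C \<noteq> {}" using C(1) unfolding vertex_cover_def by blast
      moreover have "x \<notin> C" using vN vL' unfolding N_def by metis
      ultimately have "y \<in> C" by simp
      then show "v \<notin> \<Union>(N y)" using vL' by (simp add: N_def)
    qed (use L L' in \<open>auto simp: N_def induced_matching_empty\<close>)
    have "card (product_edges ?V v N {}) = (\<Sum>x\<in>?V. card (N x))"
      using L(1) L' by (subst card_product_edges[OF G H]) (auto simp: N_def induced_matching_iff)
    moreover have "(\<Sum>x\<in>?V. card (N x)) + card C = (\<Sum>x\<in>?V. card (N x) + of_bool (x \<in> C))"
      using sum_of_bool_eq_card[OF fin CV] by (simp add: sum.distrib)
    moreover have "\<dots> = (\<Sum>x\<in>?V. ?k)"
      using L card_L' by (intro sum.cong) (auto simp: N_def)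
    ultimately show "card (product_edges ?V v N {}) = card ?V * ?k - vertex_cover_number G"
      using C(2) by simp
    fix M assume M: "induced_matching (rooted_product G v H) M"
    obtain N T where *: "card M = (\<Sum>x\<in>verts G. card (N x)) + card T"
        "\<forall>x\<in>verts G. induced_matching H (N x)"
        "T \<subseteq> verts G" "card T \<le> induced_matching_number G"
        "\<forall>x\<in>T. free_at H v (N x)"
        "\<forall>x \<in> T \<union> {x. v \<in> \<Union>(N x)}. \<forall>y \<in> T \<union> {x. v \<in> \<Union>(N x)}. {x, y} \<notin> edges G"
      using induced_matching_rooted_product_decompose[OF G H M] .
    \<comment> \<open>The complement in \<open>?V\<close> of the independent set supplied by the
      decomposition, hence a vertex cover.\<close>
    define D where "D = {x \<in> ?V. x \<notin> T \<and> v \<notin> \<Union>(N x)}"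
    have "vertex_cover G D"
      unfolding vertex_cover_def
    proof (intro conjI ballI)
      show "D \<subseteq> ?V" by (auto simp: D_def)
      fix e assume e: "e \<in> edges G"
      then obtain x y where xy: "e = {x, y}" using edge_eq_pair[OF G] by blast
      have "x \<in> ?V" "y \<in> ?V" using edge_verts[OF G] e xy by auto
      moreover have "\<not> (x \<in> T \<union> {x. v \<in> \<Union>(N x)} \<and> y \<in> T \<union> {x. v \<in> \<Union>(N x)})"
        using *(6) e xy by fast
      ultimately have "x \<in> D \<or> y \<in> D" by (auto simp: D_def)
      then show "e \<inter> D \<noteq> {}" using xy by blast
    qed
    then have D: "vertex_cover_number G \<le> card D" by (rule vertex_cover_number_le[OF G])
    \<comment> \<open>Over \<open>T\<close> as well as over \<open>D\<close> the fibre misses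
      \<open>v\<close> and so falls short of \<open>?k\<close>. As \<open>T\<close> and
      \<open>D\<close> are disjoint, a shortfall of one per fibre pays for both.\<close>
    have "card M + card D = (\<Sum>x\<in>?V. card (N x) + of_bool (x \<in> T) + of_bool (x \<in> D))"
      using * sum_of_bool_eq_card[OF fin *(3)] sum_of_bool_eq_card[OF fin, of D]
      by (simp add: sum.distrib D_def)
    also have "\<dots> \<le> (\<Sum>x\<in>?V. ?k)"
    proof (rule sum_mono)
      fix x assume "x \<in> ?V"
      then have le: "card (N x) \<le> ?k" and less: "v \<notin> \<Union>(N x) \<Longrightarrow> card (N x) < ?k"
        using card_le_induced_matching_number[OF H, of "N x"] covered[of "N x"] *(2) by auto
      show "card (N x) + of_bool (x \<in> T) + of_bool (x \<in> D) \<le> ?k"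
      proof (cases "x \<in> T \<or> x \<in> D")
        case True
        then have "v \<notin> \<Union>(N x)" using free_at_not_covered[of H v "N x"] *(5) by (auto simp: D_def)
        moreover have "\<not> (x \<in> T \<and> x \<in> D)" by (simp add: D_def)
        ultimately show ?thesis using less by (cases "x \<in> T") simp_all
      next
        case False
        then show ?thesis using le by simp
      qed
    qed
    finally show "card M \<le> card ?V * ?k - vertex_cover_number G"
      using D by simp
  qed
  \<comment> \<open>This makes the subtraction on \<open>nat\<close> genuine. It rests on
    \<open>?k\<close> being positive, since \<open>L\<close> contains the edge
    \<open>d\<close>.\<close>
  moreover have "vertex_cover_number G \<le> card ?V * ?k"
  proof -
    have "card C * 1 \<le> card ?V * ?k"
      using card_mono[OF fin CV] k by (intro mult_le_mono) auto
    then show ?thesis using C(2) by simp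
  qed
  ultimately show ?thesis by simp
qed

section \<open>Choosing among the three values\<close>

theorem theorem6p1:
  fixes G :: "'a ugraph" and H :: "'b ugraph" and v :: 'b and n :: nat
  assumes "finite_simple_graph G"
    and "card (verts G) = n"
    and "finite_simple_graph H"
    and "v \<in> verts H"
  shows "int (induced_matching_number (rooted_product G v H)) \<in>
    {int n * int (induced_matching_number H) - int (vertex_cover_number G),
     int n * int (induced_matching_number H),
     int n * int (induced_matching_number H) + int (induced_matching_number G)}"
proof -
  let ?max = "\<lambda>L. induced_matching H L \<and> card L = induced_matching_number H"
  note hyps = assms(1,3,4)
  \<comment> \<open>The split asks first for a free maximum induced matching, then for one that
    merely misses \<open>v\<close>. The cases exclude each other, because a free matching misses
    \<open>v\<close>.\<close>
  consider (free) L where "?max L" "free_at H v L"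
    | (uncovered) L where "?max L" "v \<notin> \<Union>L" "\<And>L. ?max L \<Longrightarrow> \<not> free_at H v L"
    | (covered) "\<And>L. ?max L \<Longrightarrow> v \<in> \<Union>L"
    by blast
  then show ?thesis
  proof cases
    case free
    then show ?thesis
      using induced_matching_number_rooted_product_free[OF hyps] assms(2) by auto
  next
    case uncovered
    then have "induced_matching_number (rooted_product G v H) = n * induced_matching_number H"
      using induced_matching_number_rooted_product_uncovered[OF hyps, of L] assms(2) by blast
    then show ?thesis by simp
  next
    case covered
    then have "induced_matching_number (rooted_product G v H) + vertex_cover_number G =
        n * induced_matching_number H"
      using induced_matching_number_rooted_product_covered[OF hyps] assms(2) by blast
    then have "int (induced_matching_number (rooted_product G v H)) + int (vertex_cover_number G) =
        int n * int (induced_matching_number H)"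
      by (metis of_nat_add of_nat_mult)
    then show ?thesis by simp
  qed
qed

end
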